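(* Let $k$ be a positive integer that is not a perfect square. There exist constants $C_1, C_2 > 0$ and $N_0$, depending only on $k$, such that for every $N \ge N_0$ and every positive integer $r \le N$ the following holds. Let $A_N = \{ x_1 + x_2\sqrt{k} : x_1, x_2 \in \mathbb{Z} \cap [-\sqrt{N}, \sqrt{N}] \}$ and $\mathcal{P} = A_N \times A_N \subset \mathbb{R}^2$. Then there exists a set $\mathcal{L}_r$ of lines in $\mathbb{R}^2$, each of which is $r$-rich with respect to $\mathcal{P}$, such that $$ C_1 \left( \frac{|\mathcal{P}|^2}{r^3} + \frac{|\mathcal{P}|}{r} \right) \le |\mathcal{L}_r| \le C_2 \left( \frac{|\mathcal{P}|^2}{r^3} + \frac{|\mathcal{P}|}{r} \right). $$
   Context: A line in $\mathbb{R}^2$ is called $r$-rich with respect to a finite point set $\mathcal{P} \subset \mathbb{R}^2$ if it contains at least $r$ points of $\mathcal{P}$. $|\cdot|$ denotes cardinality. *)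

theory Defs
  imports "HOL-Analysis.Analysis"
begin

(* Lines in the plane, which is taken to be real \<times> real so that the point set is
   literally the product of two sets of reals. *)
definition is_line :: "(real \<times> real) set \<Rightarrow> bool" where
  "is_line L \<longleftrightarrow> affine L \<and> aff_dim L = 1"

(* Meaningful for finite P only: for an infinite intersection card would be 0. *)
definition rich_line :: "(real \<times> real) set \<Rightarrow> nat \<Rightarrow> (real \<times> real) set \<Rightarrow> bool" where
  "rich_line P r L \<longleftrightarrow> is_line L \<and> r \<le> card (P \<inter> L)"

definition A_set :: "nat \<Rightarrow> nat \<Rightarrow> real set" where
  "A_set k N = {real_of_int x1 + real_of_int x2 * sqrt (real k) | x1 x2.
     real_of_int x1 \<in> {- sqrt (real N)..sqrt (real N)} \<and>
     real_of_int x2 \<in> {- sqrt (real N)..sqrt (real N)}}"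

definition P_set :: "nat \<Rightarrow> nat \<Rightarrow> (real \<times> real) set" where
  "P_set k N = A_set k N \<times> A_set k N"

lemma finite_A_set: "finite (A_set k N)"
proof -
  define I where "I = {x::int. real_of_int x \<in> {- sqrt (real N)..sqrt (real N)}}"
  have "I \<subseteq> {\<lceil>- sqrt (real N)\<rceil>..\<lfloor>sqrt (real N)\<rfloor>}"
    by (auto simp: I_def ceiling_le_iff le_floor_iff)
  then have "finite I"
    by (rule finite_subset) simp
  moreover have "A_set k N = (\<lambda>(x1, x2). real_of_int x1 + real_of_int x2 * sqrt (real k)) ` (I \<times> I)"
    by (auto simp: A_set_def I_def)
  ultimately show ?thesis by simp
qed

lemma finite_P_set: "finite (P_set k N)"
  by (simp add: P_set_def finite_A_set)

end

theory Submission
  imports Defs "HOL-Computational_Algebra.Primes"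
begin

text \<open>
  For \<open>r \<le> N\<close> the term \<open>|P|\<^sup>2 / r\<^sup>3\<close> dominates \<open>|P| / r\<close>, and \<open>|P|\<close> has order
  \<open>N\<^sup>2\<close>. Any subset of a family of rich lines is again such a family, so the upper bound is met by
  discarding lines, and the content is that there are at least \<open>c N\<^sup>4 / r\<^sup>3\<close> many \<open>r\<close>-rich
  lines (lemma \<open>many_rich_lines\<close>).

  The lines are those of the classical grid construction, carried out over the ring
  \<open>\<int>[\<surd>k]\<close>. Write \<open>S\<close> for the integer part of \<open>\<surd>N\<close>, \<open>U\<close> for \<open>\<surd>r\<close> rounded up, and let
  \<open>h\<close> have order \<open>S / U\<close>. A line through a point \<open>(x, y)\<close> of the grid with coordinates of size at
  most \<open>S / 2\<close>, in a direction \<open>(a, b)\<close> with entries of size \<open>O(h)\<close>, contains the points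
  \<open>(x + t a, y + t b)\<close> for all \<open>t\<close> with coordinates in \<open>{0..<U}\<close>. These are
  \<open>U\<^sup>2 \<ge> r\<close> points, and a suitable constant in the choice of \<open>h\<close> keeps them inside the grid.
  There are of order \<open>S\<^sup>4\<close> starting points and \<open>h\<^sup>4\<close> directions.

  The difficulty is to see that these data do not describe the same line too often. Over \<open>\<int>\<close> one
  would take coprime directions; but \<open>\<int>[\<surd>k]\<close> has infinitely many units and need not have unique
  factorisation. Two restrictions replace coprimality. The norms of \<open>a\<close> and \<open>b\<close> are coprime
  integers; then a Bezout relation between the norms shows that every vector over \<open>\<int>[\<surd>k]\<close>
  parallel to \<open>(a, b)\<close> is a multiple of it by an element of \<open>\<int>[\<surd>k]\<close> (lemma
  \<open>primitive_direction\<close>). Also \<open>a\<close>, \<open>b\<close> and their conjugates are bounded below by a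
  multiple of \<open>h\<close>; so all multipliers that occur are bounded together with their conjugates, and
  there are \<open>O(1)\<close> multipliers between two directions and \<open>O(U\<^sup>2)\<close> between two starting points on
  a line. Hence the number of lines is at least of order
  \<open>S\<^sup>4 h\<^sup>4 / U\<^sup>2\<close>, that is \<open>S\<^sup>8 / U\<^sup>6\<close> or \<open>N\<^sup>4 / r\<^sup>3\<close>.

  That a positive proportion of the directions has coprime norms is a sieve (lemma
  \<open>many_coprime_norms\<close>). The entries are taken congruent to 1 modulo \<open>Q = m!\<close>, which keeps
  all primes up to \<open>m\<close> out of the norms. For a prime \<open>p > m\<close> the proportion of entries with norm
  divisible by \<open>p\<close> is \<open>O(1 / p + 1 / h\<^sup>2)\<close>, by a pigeonhole argument that uses only that a nonzero norm
  divisible by \<open>p\<close> has absolute value at least \<open>p\<close>. The proportions of pairs lost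
  to the individual primes sum to \<open>O(1 / m)\<close> when \<open>h\<close> is large in terms of \<open>m\<close>.

  All this requires \<open>h\<close> to exceed a constant. Otherwise \<open>N / r\<close> is bounded, and the horizontal
  lines through the grid suffice.
\<close>

section \<open>The ring of integers with a square root adjoined\<close>

locale nonsquare =
  fixes k :: nat
  assumes k_pos: "k > 0" and not_square: "\<not> (\<exists>m::nat. k = m ^ 2)"
begin

text \<open>
  A pair \<open>(x, y)\<close> stands for \<open>x + y \<surd>k\<close>; as \<open>k\<close> is not a square, \<open>emb\<close> is injective and
  pairs and reals can be exchanged. Working with pairs makes conjugation a total function.
\<close>

definition emb :: "int \<times> int \<Rightarrow> real" where
  "emb z = real_of_int (fst z) + real_of_int (snd z) * sqrt (real k)"

definition conjugate :: "int \<times> int \<Rightarrow> int \<times> int" where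
  "conjugate z = (fst z, - snd z)"

definition nrm :: "int \<times> int \<Rightarrow> int" where
  "nrm z = (fst z)\<^sup>2 - int k * (snd z)\<^sup>2"

definition mul :: "int \<times> int \<Rightarrow> int \<times> int \<Rightarrow> int \<times> int" where
  "mul z w = (fst z * fst w + int k * (snd z * snd w), fst z * snd w + snd z * fst w)"

lemma nrm_eq_0_iff: "nrm z = 0 \<longleftrightarrow> z = 0"
proof
  assume *: "nrm z = 0"
  obtain x y where z: "z = (x, y)" by (cases z)
  from * have eq: "x\<^sup>2 = int k * y\<^sup>2" by (simp add: nrm_def z)
  have "y = 0"
  proof (rule ccontr)
    assume "y \<noteq> 0"
    have "y\<^sup>2 dvd x\<^sup>2" using eq by simp
    then have "y dvd x" by simp
    then obtain c where "x = y * c" by blast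
    with eq \<open>y \<noteq> 0\<close> have "int k = c\<^sup>2" by (simp add: power_mult_distrib)
    then have "int k = int ((nat \<bar>c\<bar>)\<^sup>2)" by simp
    then have "k = (nat \<bar>c\<bar>)\<^sup>2" by (metis of_nat_eq_iff)
    with not_square show False by blast
  qed
  with eq show "z = 0" by (simp add: z zero_prod_def)
qed (simp add: nrm_def)

lemma emb_mul: "emb (mul z w) = emb z * emb w"
  by (simp add: emb_def mul_def algebra_simps)

lemma conjugate_mul: "conjugate (mul z w) = mul (conjugate z) (conjugate w)"
  by (simp add: conjugate_def mul_def algebra_simps)

lemma emb_conjugate: "emb (conjugate z) = real_of_int (fst z) - real_of_int (snd z) * sqrt (real k)"
  by (simp add: emb_def conjugate_def)

lemma nrm_eq_emb: "real_of_int (nrm z) = emb z * emb (conjugate z)"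
proof -
  have "emb z * emb (conjugate z) = (real_of_int (fst z))\<^sup>2 - (real_of_int (snd z))\<^sup>2 * (sqrt (real k))\<^sup>2"
    unfolding emb_conjugate unfolding emb_def by (simp add: power2_eq_square algebra_simps)
  then show ?thesis by (simp add: nrm_def)
qed

lemma emb_add: "emb (z + w) = emb z + emb w"
  by (simp add: emb_def algebra_simps)

lemma emb_diff: "emb (z - w) = emb z - emb w"
  by (simp add: emb_def algebra_simps)

lemma emb_eq_0_iff: "emb z = 0 \<longleftrightarrow> z = 0"
proof
  assume "emb z = 0"
  then have "real_of_int (nrm z) = 0" by (simp add: nrm_eq_emb)
  then show "z = 0" by (simp add: nrm_eq_0_iff)
qed (simp add: emb_def)

lemma inj_emb: "inj emb"
  by (rule injI) (metis emb_diff emb_eq_0_iff eq_iff_diff_eq_0)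

lemma sqrt_k_bounds: "1 \<le> sqrt (real k)" "sqrt (real k) \<le> real k"
proof -
  have k1: "1 \<le> real k" using k_pos by simp
  then show "1 \<le> sqrt (real k)" by simp
  show "sqrt (real k) \<le> real k"
    using k1 by (intro real_le_lsqrt) (auto simp: power2_eq_square)
qed

text \<open>
  The coordinates are recovered from the half sum and half difference of the two conjugates. This is
  the reason why there are only finitely many elements bounded together with their conjugate,
  although \<open>\<int>[\<surd>k]\<close> is dense in the reals.
\<close>

lemma coordinates_bounded:
  assumes "\<bar>emb z\<bar> \<le> B" "\<bar>emb (conjugate z)\<bar> \<le> B"
  shows "\<bar>real_of_int (fst z)\<bar> \<le> B" "\<bar>real_of_int (snd z)\<bar> \<le> B"
proof -
  have "2 * real_of_int (fst z) = emb z + emb (conjugate z)"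
    unfolding emb_conjugate by (simp add: emb_def)
  then show "\<bar>real_of_int (fst z)\<bar> \<le> B" using assms by linarith
  have "2 * (real_of_int (snd z) * sqrt (real k)) = emb z - emb (conjugate z)"
    unfolding emb_conjugate by (simp add: emb_def)
  then have "\<bar>real_of_int (snd z) * sqrt (real k)\<bar> \<le> B" using assms by linarith
  moreover have "\<bar>real_of_int (snd z)\<bar> * 1 \<le> \<bar>real_of_int (snd z)\<bar> * sqrt (real k)"
    using sqrt_k_bounds(1) by (intro mult_left_mono) auto
  ultimately show "\<bar>real_of_int (snd z)\<bar> \<le> B" by (simp add: abs_mult)
qed

text \<open>
  If \<open>u nrm a0 + v nrm b0 = 1\<close>, then the real factor \<open>\<mu>\<close> equals
  \<open>u a0' (\<mu> a0) + v b0' (\<mu> b0)\<close>, where a prime denotes the conjugate; the bracketed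
  products are elements of the ring, hence so is \<open>\<mu>\<close>.
\<close>

lemma primitive_direction:
  assumes cop: "coprime (nrm a0) (nrm b0)"
    and a: "emb a = \<mu> * emb a0" and b: "emb b = \<mu> * emb b0"
  obtains m where "a = mul m a0" "b = mul m b0"
proof -
  obtain u v where uv: "u * nrm a0 + v * nrm b0 = 1"
    using cop bezout_int[of "nrm a0" "nrm b0"] by auto
  define m where "m = mul (u, 0) (mul (conjugate a0) a) + mul (v, 0) (mul (conjugate b0) b)"
  have "emb m = real_of_int u * (emb (conjugate a0) * (\<mu> * emb a0)) + real_of_int v * (emb (conjugate b0) * (\<mu> * emb b0))"
    by (simp only: m_def emb_add emb_mul a b) (simp add: emb_def)
  also have "\<dots> = \<mu> * real_of_int (u * nrm a0 + v * nrm b0)"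
    by (simp add: nrm_eq_emb algebra_simps)
  finally have m: "emb m = \<mu>" by (simp add: uv)
  have "a = mul m a0" "b = mul m b0"
    using inj_emb a b by (auto simp: emb_mul m inj_eq[symmetric])
  then show thesis ..
qed

section \<open>Elements whose norm is divisible by a prime\<close>

text \<open>
  The classes play the role of the prime ideals above \<open>p\<close>. If \<open>k\<close> has a square root \<open>s\<close> modulo
  \<open>p\<close>, the norm factors modulo \<open>p\<close> and the classes are \<open>x = s y\<close> and \<open>x = - s y\<close>; if not,
  \<open>p\<close> divides both coordinates and one class is enough. Each class is closed under differences.
\<close>

lemma norm_divisible_classes:
  assumes p: "prime p"
  obtains I J where "{z. p dvd nrm z} \<subseteq> I \<union> J"
    "\<And>z w. z \<in> I \<Longrightarrow> w \<in> I \<Longrightarrow> p dvd nrm (z - w)"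
    "\<And>z w. z \<in> J \<Longrightarrow> w \<in> J \<Longrightarrow> p dvd nrm (z - w)"
proof (cases "\<exists>s. p dvd s\<^sup>2 - int k")
  case True
  then obtain s where s: "p dvd s\<^sup>2 - int k" by blast
  define L where "L = (\<lambda>t. {z. p dvd fst z - t * snd z})"
  have factor: "nrm z = (fst z - s * snd z) * (fst z - (- s) * snd z) + (s\<^sup>2 - int k) * (snd z)\<^sup>2" for z
    by (simp add: nrm_def algebra_simps power2_eq_square)
  have "{z. p dvd nrm z} \<subseteq> L s \<union> L (- s)"
  proof
    fix z assume "z \<in> {z. p dvd nrm z}"
    then have "p dvd (fst z - s * snd z) * (fst z - (- s) * snd z)"
      using s factor[of z] by (metis dvd_add_left_iff dvd_mult2 mem_Collect_eq)
    then show "z \<in> L s \<union> L (- s)"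
      using p by (auto simp: L_def prime_dvd_mult_iff)
  qed
  moreover have "p dvd nrm (z - w)" if "z \<in> L t" "w \<in> L t" "t = s \<or> t = - s" for z w t
  proof -
    have "p dvd (fst z - t * snd z) - (fst w - t * snd w)"
      using that by (auto simp: L_def)
    then have "p dvd fst (z - w) - t * snd (z - w)" by (simp add: algebra_simps)
    then have "p dvd (fst (z - w) - s * snd (z - w)) * (fst (z - w) - (- s) * snd (z - w))"
      using that(3) by (metis dvd_mult dvd_mult2)
    then show ?thesis unfolding factor using s by (meson dvd_add dvd_mult2)
  qed
  ultimately show thesis using that[of "L s" "L (- s)"] by blast
next
  case False
  define L where "L = {z. p dvd fst z \<and> p dvd snd z}"
  have "{z. p dvd nrm z} \<subseteq> L"
  proof
    fix z assume "z \<in> {z. p dvd nrm z}"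
    then have pz: "p dvd (fst z)\<^sup>2 - int k * (snd z)\<^sup>2" by (simp add: nrm_def)
    have "p dvd snd z"
    proof (rule ccontr)
      assume "\<not> p dvd snd z"
      then have "coprime p (snd z)" using p by (rule prime_imp_coprime[rotated])
      then obtain u t where "u * p + t * snd z = 1"
        using bezout_int[of p "snd z"] by auto
      then have t: "t * snd z = 1 - u * p" by simp
      \<comment> \<open>If \<open>snd z\<close> were invertible modulo \<open>p\<close> with inverse \<open>t\<close>, then \<open>t * fst z\<close> would be a root of \<open>k\<close>.\<close>
      have "(t * fst z)\<^sup>2 - int k = t\<^sup>2 * ((fst z)\<^sup>2 - int k * (snd z)\<^sup>2) + int k * ((t * snd z)\<^sup>2 - 1)"
        by (simp add: algebra_simps power2_eq_square)
      also have "\<dots> = t\<^sup>2 * ((fst z)\<^sup>2 - int k * (snd z)\<^sup>2) + p * (int k * u * (u * p - 2))"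
        unfolding t by (simp add: algebra_simps power2_eq_square)
      finally have "p dvd (t * fst z)\<^sup>2 - int k" using pz by simp
      with False show False by blast
    qed
    moreover from this have "p dvd (fst z)\<^sup>2"
      using pz by (metis dvd_diff_left_iff dvd_mult dvd_power zero_less_numeral dvd_trans)
    ultimately show "z \<in> L"
      using p by (auto simp: L_def dest: prime_dvd_power)
  qed
  moreover have "p dvd nrm (z - w)" if "z \<in> L" "w \<in> L" for z w
  proof -
    have "p dvd fst z - fst w" "p dvd snd z - snd w" using that by (auto simp: L_def)
    then show ?thesis by (auto simp: nrm_def power2_eq_square intro!: dvd_diff)
  qed
  ultimately show thesis using that[of L L] by blast
qed

definition square :: "nat \<Rightarrow> (int \<times> int) set" where
  "square h = {0..<int h} \<times> {0..<int h}"

lemma finite_square [simp]: "finite (square h)" by (simp add: square_def)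

lemma card_square: "card (square h) = h\<^sup>2" by (simp add: square_def power2_eq_square)

text \<open>
  Cut the square into cells of side about \<open>\<surd>(p / k)\<close>. Two elements of \<open>V\<close> in one cell differ by
  an element whose norm is smaller than \<open>p\<close> and divisible by \<open>p\<close>, hence zero; so a cell
  contains at most one element of \<open>V\<close>. The summand 1 covers primes so large that there is only one cell.
\<close>

lemma card_norm_divisible_differences:
  assumes p: "p > 0" and V: "V \<subseteq> square h"
    and div: "\<And>z w. z \<in> V \<Longrightarrow> w \<in> V \<Longrightarrow> p dvd nrm (z - w)"
  shows "real (card V) \<le> 2 * (real k * real h ^ 2 / real_of_int p + 1)"
proof -
  define \<rho> where "\<rho> = sqrt (real_of_int p / real k)"
  have \<rho>: "\<rho> > 0" "\<rho>\<^sup>2 = real_of_int p / real k" using p k_pos by (auto simp: \<rho>_def)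
  define e where "e = \<lceil>\<rho>\<rceil>"
  have e: "e \<ge> 1" "real_of_int e \<ge> \<rho>" "real_of_int (e - 1) < \<rho>"
    using \<rho>(1) unfolding e_def by linarith+
  have "(real_of_int (e - 1))\<^sup>2 < \<rho>\<^sup>2" using e by (intro power_strict_mono) auto
  then have "real k * (real_of_int (e - 1))\<^sup>2 < real_of_int p"
    using k_pos by (simp add: \<rho> field_simps)
  then have "real_of_int (int k * (e - 1)\<^sup>2) < real_of_int p" by simp
  then have small: "int k * (e - 1)\<^sup>2 < p" by (simp only: of_int_less_iff)
  define c where "c = (\<lambda>z::int\<times>int. (fst z div e, snd z div e))"
  \<comment> \<open>Rounding \<open>\<rho>\<close> up is harmless: coordinates in one cell differ by at most \<open>e - 1 < \<rho>\<close>.\<close>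
  have near: "(x - y)\<^sup>2 \<le> (e - 1)\<^sup>2" if "x div e = y div e" for x y :: int
  proof -
    have "x - y = x mod e - y mod e"
      by (metis add_diff_cancel_left div_mult_mod_eq that)
    moreover have "0 \<le> x mod e" "x mod e < e" "0 \<le> y mod e" "y mod e < e" using e by auto
    ultimately have "\<bar>x - y\<bar> \<le> e - 1" by linarith
    then have "\<bar>x - y\<bar>\<^sup>2 \<le> (e - 1)\<^sup>2" by (intro power_mono) auto
    then show ?thesis by simp
  qed
  have "inj_on c V"
  proof (rule inj_onI)
    fix z w assume zw: "z \<in> V" "w \<in> V" "c z = c w"
    have d1: "(fst z - fst w)\<^sup>2 \<le> (e - 1)\<^sup>2" and d2: "(snd z - snd w)\<^sup>2 \<le> (e - 1)\<^sup>2"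
      using zw near by (auto simp: c_def)
    have "(fst z - fst w)\<^sup>2 \<le> int k * (e - 1)\<^sup>2"
      using d1 k_pos mult_right_mono[of 1 "int k" "(e-1)\<^sup>2"] by simp
    moreover have "int k * (snd z - snd w)\<^sup>2 \<le> int k * (e - 1)\<^sup>2"
      using d2 by (intro mult_left_mono) auto
    moreover have "0 \<le> int k * (snd z - snd w)\<^sup>2" by simp
    ultimately have "\<bar>nrm (z - w)\<bar> \<le> int k * (e - 1)\<^sup>2"
      unfolding nrm_def fst_diff snd_diff using zero_le_power2[of "fst z - fst w"] by linarith
    with small have "\<bar>nrm (z - w)\<bar> < p" by simp
    with div[OF zw(1,2)] have "nrm (z - w) = 0"
      using dvd_imp_le_int[of "nrm (z - w)" p] p by force
    then show "z = w" by (simp add: nrm_eq_0_iff)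
  qed
  moreover have "c ` V \<subseteq> {0..int h div e} \<times> {0..int h div e}"
    using V e by (force simp: c_def square_def intro!: zdiv_mono1 pos_imp_zdiv_nonneg_iff[THEN iffD2])
  ultimately have "card V \<le> card ({0..int h div e} \<times> {0..int h div e})"
    by (metis card_inj_on_le finite_SigmaI finite_atLeastAtMost_int)
  also have "\<dots> = (nat (int h div e + 1))\<^sup>2" by (simp add: power2_eq_square)
  finally have "real (card V) \<le> real ((nat (int h div e + 1))\<^sup>2)" by (simp only: of_nat_le_iff)
  also have "\<dots> = (real_of_int (int h div e) + 1)\<^sup>2"
    using e by (simp add: pos_imp_zdiv_nonneg_iff)
  also have "\<dots> \<le> (real h / \<rho> + 1)\<^sup>2"
  proof (intro power_mono add_right_mono)
    have "real_of_int (int h div e) \<le> real h / real_of_int e"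
      using real_of_int_div4[of "int h" e] by simp
    also have "\<dots> \<le> real h / \<rho>" using e \<rho> by (intro divide_left_mono) auto
    finally show "real_of_int (int h div e) \<le> real h / \<rho>" .
  qed (use e in \<open>simp add: pos_imp_zdiv_nonneg_iff\<close>)
  also have "\<dots> \<le> 2 * ((real h / \<rho>)\<^sup>2 + 1)"
    using sum_squares_bound[of "real h / \<rho>" 1] by (simp add: power2_sum)
  also have "(real h / \<rho>)\<^sup>2 = real k * real h ^ 2 / real_of_int p"
    by (simp add: power_divide \<rho>)
  finally show ?thesis .
qed

section \<open>A sieve for pairs with coprime norms\<close>

text \<open>
  The entries of directions, indexed by \<open>z \<in> square h\<close>. They are 1 modulo \<open>Q\<close>, and the shift
  by \<open>2 k h\<close> makes the rational part dominate, so that the entry and its conjugate both lie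
  between \<open>Q h\<close> and a constant multiple of it (lemma \<open>dircoord_bounds\<close>).
\<close>

definition dircoord :: "nat \<Rightarrow> nat \<Rightarrow> int \<times> int \<Rightarrow> int \<times> int" where
  "dircoord Q h z = (1 + int Q * (2 * int k * int h + fst z), int Q * snd z)"

lemma inj_dircoord: "Q > 0 \<Longrightarrow> inj (dircoord Q h)"
  by (rule injI) (auto simp: dircoord_def prod_eq_iff)

lemma nrm_dircoord_unit:
  assumes "p dvd int Q" "p dvd nrm (dircoord Q h z)"
  shows "p dvd 1"
proof -
  define x y where "x = 2 * int k * int h + fst z" and "y = snd z"
  have "nrm (dircoord Q h z) = 1 + int Q * (2 * x + int Q * x\<^sup>2 - int k * int Q * y\<^sup>2)"
    unfolding nrm_def dircoord_def fst_conv snd_conv x_def[symmetric] y_def[symmetric]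
    by (simp add: algebra_simps power2_eq_square)
  then show ?thesis using assms by (metis dvd_add_left_iff dvd_mult2)
qed

lemma dircoord_bounds:
  assumes "Q > 0" "h > 0" "z \<in> square h"
  shows "real Q * real h \<le> emb (dircoord Q h z)" "emb (dircoord Q h z) \<le> 5 * real Q * real k * real h"
    "real Q * real h \<le> emb (conjugate (dircoord Q h z))" "emb (conjugate (dircoord Q h z)) \<le> 5 * real Q * real k * real h"
proof -
  obtain i j where z: "z = (i, j)" by (cases z)
  define G where "G = real Q * real h"
  have G: "G \<ge> 1" using assms by (simp add: G_def mult_ge1_I)
  have Gk: "G \<le> G * real k" using G k_pos by simp
  have i: "0 \<le> real Q * real_of_int i" "real Q * real_of_int i \<le> G"
    using assms by (auto simp: square_def z G_def intro!: mult_left_mono)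
  have j0: "0 \<le> real_of_int j" "real_of_int j \<le> real h" using assms by (auto simp: square_def z)
  have "real Q * (real_of_int j * sqrt (real k)) \<le> real Q * (real h * real k)"
    using j0 sqrt_k_bounds by (intro mult_left_mono mult_mono) auto
  then have j: "0 \<le> real Q * (real_of_int j * sqrt (real k))" "real Q * (real_of_int j * sqrt (real k)) \<le> G * real k"
    using j0 by (auto simp: G_def)
  have e: "emb (dircoord Q h z) = 1 + 2 * (G * real k) + real Q * real_of_int i + real Q * (real_of_int j * sqrt (real k))"
    by (simp add: emb_def dircoord_def z G_def algebra_simps)
  have c: "emb (conjugate (dircoord Q h z)) = 1 + 2 * (G * real k) + real Q * real_of_int i - real Q * (real_of_int j * sqrt (real k))"
    by (simp add: emb_conjugate dircoord_def z G_def algebra_simps)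
  have r: "5 * real Q * real k * real h = 5 * (G * real k)" by (simp add: G_def)
  show "real Q * real h \<le> emb (dircoord Q h z)" "emb (dircoord Q h z) \<le> 5 * real Q * real k * real h"
    "real Q * real h \<le> emb (conjugate (dircoord Q h z))" "emb (conjugate (dircoord Q h z)) \<le> 5 * real Q * real k * real h"
    unfolding e c r G_def[symmetric] using i j G Gk by linarith+
qed

lemma card_norm_divisible:
  assumes p: "prime p" and pQ: "\<not> p dvd int Q"
  shows "real (card {z \<in> square h. p dvd nrm (dircoord Q h z)}) \<le> 4 * (real k * real h ^ 2 / real_of_int p + 1)"
proof -
  obtain I J where IJ: "{z. p dvd nrm z} \<subseteq> I \<union> J"
    and I: "\<And>z w. z \<in> I \<Longrightarrow> w \<in> I \<Longrightarrow> p dvd nrm (z - w)"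
    and J: "\<And>z w. z \<in> J \<Longrightarrow> w \<in> J \<Longrightarrow> p dvd nrm (z - w)"
    using norm_divisible_classes[OF p] by blast
  have scale: "p dvd nrm (z - w)" if "p dvd nrm (dircoord Q h z - dircoord Q h w)" for z w
  proof -
    have "nrm (dircoord Q h z - dircoord Q h w) = (int Q)\<^sup>2 * nrm (z - w)"
      by (simp add: nrm_def dircoord_def algebra_simps power2_eq_square)
    then show ?thesis
      using that p pQ by (metis prime_dvd_mult_iff prime_dvd_power)
  qed
  have bound: "real (card {z \<in> square h. dircoord Q h z \<in> K}) \<le> 2 * (real k * real h ^ 2 / real_of_int p + 1)"
    if "\<And>z w. z \<in> K \<Longrightarrow> w \<in> K \<Longrightarrow> p dvd nrm (z - w)" for K
    using that scale prime_gt_0_int[OF p] by (intro card_norm_divisible_differences) auto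
  have bI: "real (card {z \<in> square h. dircoord Q h z \<in> I}) \<le> 2 * (real k * real h ^ 2 / real_of_int p + 1)"
    using I by (rule bound)
  have bJ: "real (card {z \<in> square h. dircoord Q h z \<in> J}) \<le> 2 * (real k * real h ^ 2 / real_of_int p + 1)"
    using J by (rule bound)
  have "card {z \<in> square h. p dvd nrm (dircoord Q h z)} \<le> card ({z \<in> square h. dircoord Q h z \<in> I} \<union> {z \<in> square h. dircoord Q h z \<in> J})"
    using IJ by (intro card_mono) auto
  also have "\<dots> \<le> card {z \<in> square h. dircoord Q h z \<in> I} + card {z \<in> square h. dircoord Q h z \<in> J}"
    by (rule card_Un_le)
  finally show ?thesis using bI bJ by linarith
qed

lemma sum_inverse_squares_tail:
  assumes "m \<ge> 1"
  shows "(\<Sum>p\<in>{m<..n}. 1 / (real p)\<^sup>2) \<le> 1 / real m"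
proof (cases "m \<le> n")
  case True
  then have "(\<Sum>p\<in>{m<..n}. 1 / (real p)\<^sup>2) \<le> 1 / real m - 1 / real n"
  proof (induction n rule: dec_induct)
    case (step n)
    have "{m<..Suc n} = insert (Suc n) {m<..n}" using step by auto
    then have "(\<Sum>p\<in>{m<..Suc n}. 1 / (real p)\<^sup>2) \<le> 1 / (real (Suc n))\<^sup>2 + (1 / real m - 1 / real n)"
      using step by simp
    moreover have "1 / (real (Suc n))\<^sup>2 \<le> 1 / real n - 1 / real (Suc n)"
    proof -
      have "real n > 0" using step assms by simp
      then show ?thesis by (simp add: divide_simps power2_eq_square)
    qed
    ultimately show ?case by linarith
  qed simp
  then show ?thesis by (smt (verit) of_nat_0_le_iff zero_le_divide_1_iff)
qed simp

text \<open>
  The pairs with norms not coprime are covered, over the primes \<open>p\<close>, by the pairs with both norms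
  divisible by \<open>p\<close>. Here \<open>p > m\<close>, because the norms are 1 modulo \<open>m!\<close>, and \<open>p \<le> B\<close>,
  because the norms are positive and at most \<open>B = (5 Q k h)\<^sup>2\<close>. By \<open>card_norm_divisible\<close> there are
  at most \<open>32 k\<^sup>2 h\<^sup>4 / p\<^sup>2 + 32\<close> such pairs for each \<open>p\<close>. The sum of the first terms is at most
  \<open>32 k\<^sup>2 h\<^sup>4 / m\<close>, and the sum of the second terms is at most \<open>32 B\<close>, which is of order
  \<open>h\<^sup>2\<close> only. The constants \<open>m\<close> and \<open>h0\<close> make each of the two at most
  \<open>h\<^sup>4 / 4\<close>. It matters that the bound for one prime does not involve \<open>Q\<close>, since \<open>Q\<close>
  grows with \<open>m\<close>.
\<close>

lemma many_coprime_norms: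
  obtains Q h0 where "Q > 0" "h0 > 0"
    "\<And>h. h \<ge> h0 \<Longrightarrow> real h ^ 4 / 2 \<le>
       real (card {(z, w) \<in> square h \<times> square h. coprime (nrm (dircoord Q h z)) (nrm (dircoord Q h w))})"
proof -
  define m :: nat where "m = 128 * k\<^sup>2"
  define Q :: nat where "Q = fact m"
  define h0 where "h0 = 60 * Q * k"
  have Q: "Q > 0" by (simp add: Q_def)
  have m: "m \<ge> 1" using k_pos by (simp add: m_def)
  have main: "real h ^ 4 / 2 \<le>
       real (card {(z, w) \<in> square h \<times> square h. coprime (nrm (dircoord Q h z)) (nrm (dircoord Q h w))})"
    if h: "h \<ge> h0" for h
  proof -
    have hpos: "h > 0" using h Q k_pos by (auto simp: h0_def intro: Nat.gr0I)
    define good where "good = {(z, w) \<in> square h \<times> square h. coprime (nrm (dircoord Q h z)) (nrm (dircoord Q h w))}"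
    define F where "F = (\<lambda>p::nat. {z \<in> square h. int p dvd nrm (dircoord Q h z)})"
    define B where "B = (5 * Q * k * h)\<^sup>2"
    define Pr where "Pr = {p. prime p \<and> p \<in> {m<..B}}"
    have bad: "square h \<times> square h - good \<subseteq> (\<Union>p\<in>Pr. F p \<times> F p)"
    proof
      fix v assume "v \<in> square h \<times> square h - good"
      then obtain z w where v: "v = (z, w)" "z \<in> square h" "w \<in> square h"
        and "\<not> coprime (nrm (dircoord Q h z)) (nrm (dircoord Q h w))" by (auto simp: good_def)
      then obtain c where c: "c dvd nrm (dircoord Q h z)" "c dvd nrm (dircoord Q h w)" "\<not> is_unit c"
        by (rule_tac not_coprimeE)
      note eb = dircoord_bounds[OF Q hpos v(2)]
      have pos: "0 < real Q * real h" using Q hpos by simp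
      have nb: "0 < real_of_int (nrm (dircoord Q h z))" "real_of_int (nrm (dircoord Q h z)) \<le> real B"
      proof -
        show "0 < real_of_int (nrm (dircoord Q h z))"
          unfolding nrm_eq_emb using eb pos by (intro mult_pos_pos) linarith+
        have "emb (dircoord Q h z) * emb (conjugate (dircoord Q h z)) \<le> (5 * real Q * real k * real h) * (5 * real Q * real k * real h)"
          using eb pos by (intro mult_mono) linarith+
        then show "real_of_int (nrm (dircoord Q h z)) \<le> real B"
          by (simp add: nrm_eq_emb B_def power2_eq_square)
      qed
      have "c \<noteq> 0" using c(1) nb(1) by auto
      then obtain q where q: "prime q" "q dvd c" using prime_divisor_exists c(3) by blast
      define p where "p = nat q"
      have p: "int p = q" "prime p" using q prime_gt_0_int[OF q(1)] by (auto simp: p_def)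
      have "int p dvd nrm (dircoord Q h z)" "int p dvd nrm (dircoord Q h w)"
        using q c p by (auto intro: dvd_trans)
      moreover have "m < p"
      proof (rule ccontr)
        assume "\<not> m < p"
        then have "p dvd Q" using prime_gt_0_nat[OF p(2)] by (auto simp: Q_def intro: dvd_fact)
        then have "int p dvd int Q" by simp
        then have "int p dvd 1" using calculation(1) by (rule nrm_dircoord_unit)
        then show False using p(2) by auto
      qed
      moreover have "p \<le> B"
      proof -
        have "int p \<le> nrm (dircoord Q h z)" using calculation(1) nb(1) by (intro zdvd_imp_le) auto
        then have "real p \<le> real B" using nb(2) by linarith
        then show ?thesis by simp
      qed
      ultimately show "v \<in> (\<Union>p\<in>Pr. F p \<times> F p)"
        using v p by (auto simp: F_def Pr_def)
    qed
    have finPr: "finite Pr" by (simp add: Pr_def)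
    have Fp: "real (card (F p \<times> F p)) \<le> 32 * (real k)\<^sup>2 * real h ^ 4 * (1 / (real p)\<^sup>2) + 32" if "p \<in> Pr" for p
    proof (cases "p dvd Q")
      case True
      then have "int p dvd int Q" by simp
      moreover have "\<not> int p dvd 1" using that by (auto simp: Pr_def)
      ultimately have "\<not> int p dvd nrm (dircoord Q h z)" for z by (metis nrm_dircoord_unit)
      then have "F p = {}" by (simp add: F_def)
      then show ?thesis by simp
    next
      case False
      define t where "t = real k * real h ^ 2 / real p"
      have "real (card (F p)) \<le> 4 * (t + 1)"
        using card_norm_divisible[of "int p" Q h] that False by (simp add: F_def Pr_def t_def)
      then have "real (card (F p)) * real (card (F p)) \<le> (4 * (t + 1)) * (4 * (t + 1))"
        by (intro mult_mono) (auto simp: t_def)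
      also have "\<dots> \<le> 32 * t\<^sup>2 + 32"
        using sum_squares_bound[of t 1] by (simp add: algebra_simps power2_eq_square)
      also have "t\<^sup>2 = (real k)\<^sup>2 * real h ^ 4 * (1 / (real p)\<^sup>2)"
        by (simp add: t_def power_divide power_mult_distrib)
      finally show ?thesis by (simp add: card_cartesian_product)
    qed
    have "card (square h \<times> square h - good) \<le> card (\<Union>p\<in>Pr. F p \<times> F p)"
      using bad finPr by (intro card_mono) (auto simp: F_def)
    also have "\<dots> \<le> (\<Sum>p\<in>Pr. card (F p \<times> F p))" using finPr by (rule card_UN_le)
    finally have "real (card (square h \<times> square h - good)) \<le> real (\<Sum>p\<in>Pr. card (F p \<times> F p))" by (simp only: of_nat_le_iff)
    also have "\<dots> \<le> (\<Sum>p\<in>Pr. 32 * (real k)\<^sup>2 * real h ^ 4 * (1 / (real p)\<^sup>2) + 32)"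
      using Fp by (auto intro: sum_mono)
    also have "\<dots> \<le> (\<Sum>p\<in>{m<..B}. 32 * (real k)\<^sup>2 * real h ^ 4 * (1 / (real p)\<^sup>2) + 32)"
      by (rule sum_mono2) (auto simp: Pr_def)
    also have "\<dots> = 32 * (real k)\<^sup>2 * real h ^ 4 * (\<Sum>p\<in>{m<..B}. 1 / (real p)\<^sup>2) + 32 * real (B - m)"
      by (simp add: sum.distrib sum_distrib_left)
    also have "\<dots> \<le> 32 * (real k)\<^sup>2 * real h ^ 4 * (1 / real m) + 32 * real B"
      using sum_inverse_squares_tail[OF m] by (intro add_mono mult_left_mono) auto
    also have "32 * (real k)\<^sup>2 * real h ^ 4 * (1 / real m) = real h ^ 4 / 4"
      using k_pos by (simp add: m_def field_simps)
    also have "32 * real B \<le> real h ^ 4 / 4"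
    proof -
      have "real (60 * Q * k) \<le> real h" using h unfolding h0_def by (simp only: of_nat_le_iff)
      then have "(60 * real Q * real k)\<^sup>2 \<le> (real h)\<^sup>2" by (intro power_mono) auto
      then have "(60 * real Q * real k)\<^sup>2 * (real h)\<^sup>2 \<le> (real h)\<^sup>2 * (real h)\<^sup>2" by (intro mult_right_mono) auto
      moreover have "(60 * real Q * real k)\<^sup>2 * (real h)\<^sup>2 = 144 * real B"
        by (simp add: B_def power_mult_distrib)
      moreover have "(real h)\<^sup>2 * (real h)\<^sup>2 = real h ^ 4" by (simp add: power_add[symmetric])
      moreover have "real B \<ge> 0" by simp
      ultimately show ?thesis by linarith
    qed
    finally have "real (card (square h \<times> square h - good)) \<le> real h ^ 4 / 2" by simp
    moreover have "real (card (square h \<times> square h - good)) = real h ^ 4 - real (card good)"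
    proof -
      have sub: "good \<subseteq> square h \<times> square h" by (auto simp: good_def)
      have "card (square h \<times> square h) = h ^ 4" by (simp add: card_cartesian_product card_square power_add[symmetric])
      moreover have "card good \<le> card (square h \<times> square h)" using sub by (intro card_mono) auto
      ultimately show ?thesis
        using sub by (simp add: card_Diff_subset finite_subset[OF sub] of_nat_diff)
    qed
    ultimately show ?thesis unfolding good_def[symmetric] by linarith
  qed
  show thesis by (rule that[of Q h0]) (use Q k_pos main in \<open>auto simp: h0_def\<close>)
qed

definition directions :: "nat \<Rightarrow> nat \<Rightarrow> ((int \<times> int) \<times> (int \<times> int)) set" where
  "directions Q h = {(a, b) \<in> dircoord Q h ` square h \<times> dircoord Q h ` square h. coprime (nrm a) (nrm b)}"

lemma many_directions:
  obtains Q h0 where "Q > 0" "h0 > 0" "\<And>h. h \<ge> h0 \<Longrightarrow> real h ^ 4 / 2 \<le> real (card (directions Q h))"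
proof -
  obtain Q h0 where Q: "Q > 0" "h0 > 0"
    and *: "\<And>h. h \<ge> h0 \<Longrightarrow> real h ^ 4 / 2 \<le>
       real (card {(z, w) \<in> square h \<times> square h. coprime (nrm (dircoord Q h z)) (nrm (dircoord Q h w))})"
    by (rule many_coprime_norms) blast
  have "card (directions Q h) = card {(z, w) \<in> square h \<times> square h. coprime (nrm (dircoord Q h z)) (nrm (dircoord Q h w))}" for h
  proof -
    define G where "G = {(z, w) \<in> square h \<times> square h. coprime (nrm (dircoord Q h z)) (nrm (dircoord Q h w))}"
    have "directions Q h = map_prod (dircoord Q h) (dircoord Q h) ` G"
    proof (intro set_eqI iffI)
      fix d assume "d \<in> directions Q h"
      then obtain z w where "d = map_prod (dircoord Q h) (dircoord Q h) (z, w)" "(z, w) \<in> G"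
        by (auto simp: directions_def G_def)
      then show "d \<in> map_prod (dircoord Q h) (dircoord Q h) ` G" by (rule image_eqI)
    qed (auto simp: directions_def G_def)
    moreover have "inj_on (map_prod (dircoord Q h) (dircoord Q h)) G"
      using prod.inj_map[OF inj_dircoord[OF Q(1)] inj_dircoord[OF Q(1)]] by (rule inj_on_subset) simp
    ultimately show ?thesis by (simp add: card_image G_def)
  qed
  with Q * show thesis by (intro that[of Q h0]) auto
qed

lemma finite_directions: "finite (directions Q h)"
  by (rule finite_subset[of _ "dircoord Q h ` square h \<times> dircoord Q h ` square h"]) (auto simp: directions_def)

section \<open>Counting bounded multipliers\<close>

definition bounded_elements :: "real \<Rightarrow> (int \<times> int) set" where
  "bounded_elements B = {z. \<bar>emb z\<bar> \<le> B \<and> \<bar>emb (conjugate z)\<bar> \<le> B}"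

lemma bounded_elements:
  assumes "B \<ge> 0"
  shows "finite (bounded_elements B)" "real (card (bounded_elements B)) \<le> (2 * B + 1)\<^sup>2"
proof -
  let ?R = "{- \<lfloor>B\<rfloor>..\<lfloor>B\<rfloor>} \<times> {- \<lfloor>B\<rfloor>..\<lfloor>B\<rfloor>}"
  have sub: "bounded_elements B \<subseteq> ?R"
  proof
    fix z assume "z \<in> bounded_elements B"
    then have "\<bar>real_of_int (fst z)\<bar> \<le> B" "\<bar>real_of_int (snd z)\<bar> \<le> B"
      using coordinates_bounded by (auto simp: bounded_elements_def)
    then have "\<bar>fst z\<bar> \<le> \<lfloor>B\<rfloor>" "\<bar>snd z\<bar> \<le> \<lfloor>B\<rfloor>" by (auto simp: le_floor_iff)
    then show "z \<in> ?R" by (auto simp: mem_Times_iff)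
  qed
  then show "finite (bounded_elements B)" by (rule finite_subset) simp
  have "card (bounded_elements B) \<le> card ?R" using sub by (intro card_mono) auto
  then have "real (card (bounded_elements B)) \<le> real (card ?R)" by (simp only: of_nat_le_iff)
  also have "\<dots> = (2 * real_of_int \<lfloor>B\<rfloor> + 1)\<^sup>2" using assms by (simp add: power2_eq_square)
  also have "\<dots> \<le> (2 * B + 1)\<^sup>2" using assms by (intro power_mono) auto
  finally show "real (card (bounded_elements B)) \<le> (2 * B + 1)\<^sup>2" .
qed

lemma quotient_bounded:
  assumes "a = mul m a0" "0 < Y" "Y \<le> emb a0" "Y \<le> emb (conjugate a0)"
    and "\<bar>emb a\<bar> \<le> X" "\<bar>emb (conjugate a)\<bar> \<le> X"
  shows "m \<in> bounded_elements (X / Y)"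
proof -
  have *: "\<bar>s\<bar> \<le> X / Y" if "\<bar>s * t\<bar> \<le> X" "Y \<le> t" for s t :: real
  proof -
    have "\<bar>s\<bar> * Y \<le> \<bar>s\<bar> * \<bar>t\<bar>" using that assms(2) by (intro mult_left_mono) auto
    then show ?thesis using that assms(2) by (simp add: abs_mult field_simps)
  qed
  show ?thesis
    using assms *[of "emb m" "emb a0"] *[of "emb (conjugate m)" "emb (conjugate a0)"]
    by (simp add: bounded_elements_def conjugate_mul emb_mul)
qed

section \<open>The grid and its lines\<close>

lemma A_set_eq:
  assumes "S = nat \<lfloor>sqrt (real N)\<rfloor>"
  shows "A_set k N = emb ` ({- int S..int S} \<times> {- int S..int S})"
proof -
  have S: "int S = \<lfloor>sqrt (real N)\<rfloor>" using assms by simp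
  have "real_of_int x \<in> {- sqrt (real N)..sqrt (real N)} \<longleftrightarrow> x \<in> {- int S..int S}" for x
  proof -
    have "- sqrt (real N) \<le> real_of_int x \<longleftrightarrow> real_of_int (- x) \<le> sqrt (real N)" by auto
    then show ?thesis unfolding atLeastAtMost_iff S le_floor_iff[symmetric] by auto
  qed
  then have "A_set k N = {emb (x1, x2) | x1 x2. x1 \<in> {- int S..int S} \<and> x2 \<in> {- int S..int S}}"
    by (simp only: A_set_def emb_def fst_conv snd_conv)
  then show ?thesis by blast
qed

lemma card_A_set:
  assumes "S = nat \<lfloor>sqrt (real N)\<rfloor>"
  shows "card (A_set k N) = (2 * S + 1)\<^sup>2"
proof -
  have "card (A_set k N) = card ({- int S..int S} \<times> {- int S..int S})"
    unfolding A_set_eq[OF assms] by (intro card_image inj_on_subset[OF inj_emb]) auto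
  also have "\<dots> = (2 * S + 1)\<^sup>2" by (simp add: power2_eq_square nat_add_distrib nat_mult_distrib)
  finally show ?thesis .
qed

definition line :: "real \<times> real \<Rightarrow> real \<times> real \<Rightarrow> (real \<times> real) set" where
  "line p d = range (\<lambda>t. p + t *\<^sub>R d)"

lemma is_line_line:
  assumes "d \<noteq> 0"
  shows "is_line (line p d)"
proof -
  have "line p d = affine hull {p, p + d}"
    by (simp add: line_def affine_hull_2_alt)
  then show ?thesis using assms by (simp add: is_line_def aff_dim_2 aff_dim_affine_hull affine_affine_hull)
qed

text \<open>
  Equal lines have parallel directions and base points that differ by a multiple of the direction;
  these are the two vectors to which \<open>primitive_direction\<close> is applied later.
\<close>

lemma line_eqD:
  assumes "line p d = line p0 d0"
  obtains \<mu> \<nu> where "d = \<mu> *\<^sub>R d0" "p - p0 = \<nu> *\<^sub>R d0"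
proof -
  have "p \<in> line p d" by (auto simp: line_def intro: range_eqI[of _ _ 0])
  moreover have "p + d \<in> line p d" by (auto simp: line_def intro: range_eqI[of _ _ 1])
  ultimately obtain s t where st: "p = p0 + s *\<^sub>R d0" "p + d = p0 + t *\<^sub>R d0"
    unfolding assms unfolding line_def by blast
  then have "d = (p0 + t *\<^sub>R d0) - (p0 + s *\<^sub>R d0)" by (metis add_diff_cancel_left')
  then have "d = (t - s) *\<^sub>R d0" "p - p0 = s *\<^sub>R d0"
    using st(1) by (simp_all add: scaleR_diff_left)
  then show thesis ..
qed

abbreviation line_of :: "(int \<times> int) \<times> (int \<times> int) \<Rightarrow> (int \<times> int) \<times> (int \<times> int) \<Rightarrow> (real \<times> real) set" where
  "line_of p d \<equiv> line (map_prod emb emb p) (map_prod emb emb d)"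

definition quadrant :: "nat \<Rightarrow> (int \<times> int) set" where
  "quadrant Z = {0..int Z} \<times> {0..int Z}"

text \<open>
  All coordinates involved are nonnegative, so the product of \<open>t\<close> and \<open>a\<close> has nonnegative
  coordinates too. They are at most \<open>4 k Q U h\<close>, because \<open>a\<close> has first coordinate at most
  \<open>3 k Q h\<close> and second coordinate at most \<open>Q h\<close>; this is less than \<open>S / 2\<close>.
\<close>

lemma translate_in_quadrant:
  assumes x: "x \<in> quadrant (S div 2)" and t: "t \<in> square U" and a: "a \<in> dircoord Q h ` square h"
    and S: "10 * k * Q * U * h \<le> S" and Q: "Q > 0" and h: "h > 0"
  shows "x + mul t a \<in> quadrant S"
proof -
  obtain z where z: "z \<in> square h" "a = dircoord Q h z" using a by blast
  define G where "G = int k * int Q * int h"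
  have k1: "int k \<ge> 1" using k_pos by simp
  have Qh: "int Q * int h \<le> G"
    using mult_right_mono[OF k1, of "int Q * int h"] by (simp add: G_def mult.assoc)
  have a2: "0 \<le> snd a" "snd a \<le> int Q * int h"
    using z by (auto simp: dircoord_def square_def intro!: mult_left_mono)
  have "int Q * fst z \<le> int Q * (int h - 1)" "0 \<le> int Q * fst z"
    using z by (auto simp: square_def intro!: mult_left_mono)
  moreover have "int Q * (2 * int k * int h) = 2 * G" by (simp add: G_def)
  moreover have "int Q * (int h - 1) = int Q * int h - int Q" by (simp add: algebra_simps)
  moreover have "int Q \<ge> 1" "G \<ge> 0" using Q by (auto simp: G_def)
  ultimately have a1: "0 \<le> fst a" "fst a \<le> 3 * G"
    using Qh by (auto simp: z dircoord_def distrib_left)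
  have t': "0 \<le> fst t" "fst t \<le> int U" "0 \<le> snd t" "snd t \<le> int U" using t by (auto simp: square_def)
  have "10 * (int U * G) \<le> int S"
    using S unfolding G_def by (simp add: of_nat_le_iff[where 'a=int, symmetric] mult_ac)
  then have UG: "int U * G * 4 \<le> int S - int (S div 2)" using \<open>G \<ge> 0\<close> by (simp add: zdiv_int)
  have k2: "0 \<le> int k * snd a" "int k * snd a \<le> G"
    using a2 mult_left_mono[OF a2(2), of "int k"] by (auto simp: G_def mult.assoc)
  have m1: "fst t * fst a \<le> int U * (3 * G)" using t' a1 \<open>G \<ge> 0\<close> by (intro mult_mono) auto
  have m2: "snd t * (int k * snd a) \<le> int U * G" using t' k2 \<open>G \<ge> 0\<close> by (intro mult_mono) auto
  have m3: "fst t * snd a \<le> int U * G" using t' a2 Qh \<open>G \<ge> 0\<close> by (intro mult_mono) auto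
  have m4: "snd t * fst a \<le> int U * (3 * G)" using t' a1 \<open>G \<ge> 0\<close> by (intro mult_mono) auto
  have p: "0 \<le> fst t * fst a" "0 \<le> snd t * (int k * snd a)" "0 \<le> fst t * snd a" "0 \<le> snd t * fst a"
    using t' a1 a2 k2 by auto
  have "fst (mul t a) = fst t * fst a + snd t * (int k * snd a)" "snd (mul t a) = fst t * snd a + snd t * fst a"
    by (auto simp: mul_def)
  then show ?thesis
    using m1 m2 m3 m4 p x UG by (auto simp: quadrant_def mem_Times_iff)
qed

lemma rich_line_of:
  assumes S: "S = nat \<lfloor>sqrt (real N)\<rfloor>" "10 * k * Q * U * h \<le> S" and U: "r \<le> U\<^sup>2"
    and Q: "Q > 0" and h: "h > 0"
    and p: "p \<in> quadrant (S div 2) \<times> quadrant (S div 2)" and d: "d \<in> directions Q h"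
  shows "rich_line (P_set k N) r (line_of p d)"
proof -
  obtain x y a b where eq: "p = (x, y)" "d = (a, b)" by (cases p, cases d) auto
  have ab: "a \<in> dircoord Q h ` square h" "b \<in> dircoord Q h ` square h" using d by (auto simp: eq directions_def)
  have "0 < real Q * real h" using Q h by simp
  then have a0: "emb a \<noteq> 0" using ab(1) dircoord_bounds[OF Q h] by fastforce
  define f where "f = (\<lambda>t. (emb (x + mul t a), emb (y + mul t b)))"
  have "inj_on f (square U)"
    by (rule inj_onI) (use a0 inj_emb in \<open>auto simp: f_def emb_add emb_mul inj_eq\<close>)
  then have "card (f ` square U) = U\<^sup>2" by (simp add: card_image card_square)
  moreover have "f ` square U \<subseteq> P_set k N \<inter> line_of p d"
  proof
    fix v assume "v \<in> f ` square U"
    then obtain t where t: "t \<in> square U" "v = f t" by blast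
    have "v = map_prod emb emb p + emb t *\<^sub>R map_prod emb emb d"
      by (simp add: t f_def eq emb_add emb_mul)
    then have "v \<in> line_of p d" by (auto simp: line_def)
    moreover have "x + mul t a \<in> quadrant S" "y + mul t b \<in> quadrant S"
      using p t S ab Q h by (auto simp: eq intro!: translate_in_quadrant)
    then have "v \<in> P_set k N"
      by (auto simp: t f_def P_set_def A_set_eq[OF S(1)] quadrant_def intro!: imageI)
    ultimately show "v \<in> P_set k N \<inter> line_of p d" by blast
  qed
  ultimately have "U\<^sup>2 \<le> card (P_set k N \<inter> line_of p d)"
    using card_mono[of "P_set k N \<inter> line_of p d" "f ` square U"] finite_P_set by auto
  then show ?thesis
    using U a0 by (auto simp: rich_line_def eq zero_prod_def intro!: is_line_line)
qed

lemma card_le_fibre_bound: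
  assumes "finite T" "\<And>q. q \<in> T \<Longrightarrow> real (card {q' \<in> T. f q' = f q}) \<le> F"
  shows "real (card T) \<le> F * real (card (f ` T))"
proof -
  have "real (card T) = (\<Sum>y\<in>f ` T. real (card {q' \<in> T. f q' = y}))"
    using sum.image_gen[OF assms(1), of "\<lambda>_. 1 :: real" f] by simp
  also have "\<dots> \<le> (\<Sum>y\<in>f ` T. F)" using assms(2) by (intro sum_mono) auto
  finally show ?thesis by (simp add: mult.commute)
qed

lemma quadrant_difference_bounded:
  assumes "x \<in> quadrant Z" "x0 \<in> quadrant Z"
  shows "\<bar>emb (x - x0)\<bar> \<le> 2 * real k * real Z" "\<bar>emb (conjugate (x - x0))\<bar> \<le> 2 * real k * real Z"
proof -
  define u v where "u = real_of_int (fst (x - x0))" and "v = real_of_int (snd (x - x0))"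
  have "\<bar>fst (x - x0)\<bar> \<le> int Z" "\<bar>snd (x - x0)\<bar> \<le> int Z" using assms by (auto simp: quadrant_def)
  then have uv: "\<bar>u\<bar> \<le> real Z" "\<bar>v\<bar> \<le> real Z" unfolding u_def v_def by linarith+
  have "\<bar>v * sqrt (real k)\<bar> \<le> real Z * real k"
    unfolding abs_mult using uv sqrt_k_bounds by (intro mult_mono) auto
  moreover have "real Z * 1 \<le> real Z * real k" using k_pos by (intro mult_left_mono) auto
  ultimately show "\<bar>emb (x - x0)\<bar> \<le> 2 * real k * real Z" "\<bar>emb (conjugate (x - x0))\<bar> \<le> 2 * real k * real Z"
    using uv unfolding emb_conjugate emb_def[of "x - x0"] u_def[symmetric] v_def[symmetric]
    by (auto simp: abs_le_iff algebra_simps)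
qed

text \<open>
  The key multiplicity bound. If \<open>(x, y)\<close> and \<open>(a, b)\<close> describe the same line as
  \<open>(x0, y0)\<close> and \<open>(a0, b0)\<close>, then \<open>(a, b) = m (a0, b0)\<close> and
  \<open>(x - x0, y - y0) = l (a0, b0)\<close> with \<open>m\<close> and \<open>l\<close> in \<open>\<int>[\<surd>k]\<close>. As \<open>a0\<close> and its
  conjugate are at least \<open>Q h\<close>, both multipliers are bounded together with their conjugates,
  and the two factors of the bound count the choices of \<open>m\<close> and of \<open>l\<close>.
\<close>

lemma card_same_line:
  assumes Q: "Q > 0" and h: "h > 0" and p0: "p0 \<in> quadrant Z \<times> quadrant Z" and d0: "d0 \<in> directions Q h"
  shows "real (card {(p, d) \<in> (quadrant Z \<times> quadrant Z) \<times> directions Q h. line_of p d = line_of p0 d0})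
    \<le> (2 * (5 * real k) + 1)\<^sup>2 * (2 * (2 * real k * real Z / (real Q * real h)) + 1)\<^sup>2"
    (is "real (card ?F) \<le> _")
proof -
  obtain x0 y0 a0 b0 where eq: "p0 = (x0, y0)" "d0 = (a0, b0)" by (cases p0, cases d0) auto
  define Y where "Y = real Q * real h"
  have Y: "Y > 0" using Q h by (simp add: Y_def)
  define M where "M = bounded_elements (5 * real k)"
  define L where "L = bounded_elements (2 * real k * real Z / Y)"
  have cop: "coprime (nrm a0) (nrm b0)" using d0 by (simp add: eq directions_def)
  have a0: "Y \<le> emb a0" "Y \<le> emb (conjugate a0)"
    using d0 dircoord_bounds[OF Q h] by (auto simp: eq directions_def Y_def)
  define g where "g = (\<lambda>(m, l). ((x0 + mul l a0, y0 + mul l b0), (mul m a0, mul m b0)))"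
  have "?F \<subseteq> g ` (M \<times> L)"
  proof
    fix q assume "q \<in> ?F"
    then obtain x y a b where q: "q = ((x, y), (a, b))" "x \<in> quadrant Z" "y \<in> quadrant Z"
      "(a, b) \<in> directions Q h" "line_of (x, y) (a, b) = line_of p0 d0" by auto
    obtain \<mu> \<nu> where \<mu>: "map_prod emb emb (a, b) = \<mu> *\<^sub>R map_prod emb emb d0"
      and \<nu>: "map_prod emb emb (x, y) - map_prod emb emb p0 = \<nu> *\<^sub>R map_prod emb emb d0"
      using line_eqD[OF q(5)] by blast
    obtain m where m: "a = mul m a0" "b = mul m b0"
      using primitive_direction[OF cop, of a \<mu> b] \<mu> by (auto simp: eq)
    obtain l where l: "x - x0 = mul l a0" "y - y0 = mul l b0"
      using primitive_direction[OF cop, of "x - x0" \<nu> "y - y0"] \<nu> by (auto simp: eq emb_diff)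
    have "m \<in> bounded_elements ((5 * real Q * real k * real h) / Y)"
    proof (rule quotient_bounded[OF m(1) Y a0])
      obtain z where "z \<in> square h" "a = dircoord Q h z" using q(4) by (auto simp: directions_def)
      then show "\<bar>emb a\<bar> \<le> 5 * real Q * real k * real h" "\<bar>emb (conjugate a)\<bar> \<le> 5 * real Q * real k * real h"
        using dircoord_bounds[OF Q h] Y unfolding Y_def by (smt (verit))+
    qed
    then have "m \<in> M" using Q h by (simp add: M_def Y_def)
    moreover have "l \<in> L"
      unfolding L_def using p0 q quadrant_difference_bounded[of x Z x0]
      by (intro quotient_bounded[OF l(1) Y a0]) (auto simp: eq)
    moreover have "q = g (m, l)"
      using m l by (simp add: q(1) g_def flip: l)
    ultimately show "q \<in> g ` (M \<times> L)" by blast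
  qed
  moreover have fin: "finite M" "finite L" using Y by (auto simp: M_def L_def intro!: bounded_elements)
  ultimately have "card ?F \<le> card (M \<times> L)"
    by (meson card_image_le card_mono finite_SigmaI finite_imageI order_trans)
  then have "real (card ?F) \<le> real (card M) * real (card L)"
    by (simp add: card_cartesian_product flip: of_nat_mult)
  also have "\<dots> \<le> (2 * (5 * real k) + 1)\<^sup>2 * (2 * (2 * real k * real Z / Y) + 1)\<^sup>2"
    unfolding M_def L_def using Y by (intro mult_mono bounded_elements) auto
  finally show ?thesis by (simp add: Y_def)
qed

lemma finite_quadrant: "finite (quadrant Z)" by (simp add: quadrant_def)

section \<open>Families of rich lines\<close>

text \<open>
  Divide the number \<open>(S div 2 + 1)\<^sup>4 |directions Q h|\<close> of base points with a direction by the
  multiplicity bound \<open>card_same_line\<close>. The latter is \<open>O(U\<^sup>2)\<close>, because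
  \<open>S / h\<close> is at most \<open>20 k Q U\<close> by the choice of \<open>h\<close>.
\<close>

lemma many_rich_lines_wide:
  assumes S: "S = nat \<lfloor>sqrt (real N)\<rfloor>" and U: "r \<le> U\<^sup>2" "U > 0" and Q: "Q > 0"
    and h: "h = S div (10 * k * Q * U)" "h > 0"
    and dirs: "real h ^ 4 / 2 \<le> real (card (directions Q h))"
  obtains \<L> where "finite \<L>" "\<forall>L\<in>\<L>. rich_line (P_set k N) r L"
    "real S ^ 8 \<le> 32 * (20 * real k * real Q) ^ 4 * (11 * real k)\<^sup>2 * (41 * (real k)\<^sup>2)\<^sup>2 * real U ^ 6 * real (card \<L>)"
proof -
  define T where "T = (quadrant (S div 2) \<times> quadrant (S div 2)) \<times> directions Q h"
  define f where "f = (\<lambda>(p, d). line_of p d)"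
  define D where "D = 10 * k * Q * U"
  have D: "D > 0" using k_pos Q U by (simp add: D_def)
  have hD: "S < 2 * D * h" "D * h \<le> S"
  proof -
    have hS: "h = S div D" by (simp add: h(1) D_def)
    have "S < D * h + D" using mult_div_mod_eq[of D S] mod_less_divisor[OF D, of S]
      unfolding hS by linarith
    also have "\<dots> \<le> D * h + D * h" using h(2) by simp
    finally show "S < 2 * D * h" by simp
    show "D * h \<le> S" by (simp add: hS)
  qed
  define F where "F = (11 * real k)\<^sup>2 * (41 * (real k)\<^sup>2 * real U)\<^sup>2"
  have kU: "real k \<ge> 1" "real U \<ge> 1" "(real k)\<^sup>2 \<ge> 1" using k_pos U by auto
  have fin: "finite T" by (simp add: T_def finite_quadrant finite_directions)
  have fibre: "real (card {q' \<in> T. f q' = f q}) \<le> F" if "q \<in> T" for q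
  proof -
    obtain p0 d0 where q: "q = (p0, d0)" by (cases q)
    have "{q' \<in> T. f q' = f q} = {(p, d) \<in> (quadrant (S div 2) \<times> quadrant (S div 2)) \<times> directions Q h. line_of p d = line_of p0 d0}"
      by (auto simp: T_def f_def q)
    then have "real (card {q' \<in> T. f q' = f q}) \<le> (2 * (5 * real k) + 1)\<^sup>2 * (2 * (2 * real k * real (S div 2) / (real Q * real h)) + 1)\<^sup>2"
      using card_same_line[OF Q h(2), of p0 "S div 2" d0] that by (simp add: q T_def)
    also have "\<dots> \<le> F"
      unfolding F_def
    proof (intro mult_mono power_mono)
      have "real (S div 2) \<le> real D * real h"
      proof -
        have "S div 2 \<le> D * h" using hD(1) by linarith
        then show ?thesis by (metis of_nat_le_iff of_nat_mult)
      qed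
      then have "2 * real k * real (S div 2) \<le> 2 * real k * (real D * real h)"
        by (intro mult_left_mono) auto
      also have "\<dots> = 20 * (real k)\<^sup>2 * real U * (real Q * real h)"
        by (simp add: D_def power2_eq_square)
      finally have "2 * real k * real (S div 2) / (real Q * real h) \<le> 20 * (real k)\<^sup>2 * real U"
        using Q h by (simp add: pos_divide_le_eq)
      moreover have "1 \<le> (real k)\<^sup>2 * real U" using kU by (simp add: mult_ge1_I)
      ultimately show "2 * (2 * real k * real (S div 2) / (real Q * real h)) + 1 \<le> 41 * (real k)\<^sup>2 * real U"
        by simp
    qed (use kU in auto)
    finally show ?thesis .
  qed
  have upper: "real (card T) \<le> F * real (card (f ` T))" by (rule card_le_fibre_bound[OF fin fibre])
  have "card T = (S div 2 + 1) ^ 4 * card (directions Q h)"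
  proof -
    have "card (quadrant (S div 2)) = (S div 2 + 1)\<^sup>2"
      by (simp add: quadrant_def power2_eq_square nat_add_distrib)
    then show ?thesis by (simp add: T_def card_cartesian_product power_add[symmetric])
  qed
  then have T: "real (card T) = real (S div 2 + 1) ^ 4 * real (card (directions Q h))" by simp
  have s2: "real S / 2 \<le> real (S div 2 + 1)" by linarith
  have sh: "real S / (20 * real k * real Q * real U) \<le> real h"
  proof -
    have "real S \<le> real (2 * D * h)" using hD(1) by (simp only: of_nat_le_iff less_imp_le)
    also have "\<dots> = real h * (20 * real k * real Q * real U)" by (simp add: D_def)
    finally show ?thesis using k_pos Q U by (simp add: pos_divide_le_eq)
  qed
  have "(real S / 2) ^ 4 * ((real S / (20 * real k * real Q * real U)) ^ 4 / 2) \<le> real (S div 2 + 1) ^ 4 * (real h ^ 4 / 2)"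
    using s2 sh by (intro mult_mono power_mono divide_right_mono) auto
  also have "\<dots> \<le> real (card T)" unfolding T using dirs by (intro mult_left_mono) auto
  also note upper
  finally have "(real S / 2) ^ 4 * ((real S / (20 * real k * real Q * real U)) ^ 4 / 2) \<le> F * real (card (f ` T))" .
  moreover have "(real S / 2) ^ 4 * ((real S / (20 * real k * real Q * real U)) ^ 4 / 2)
      = real S ^ 8 / (32 * (20 * real k * real Q) ^ 4 * real U ^ 4)"
    by (simp add: power_divide power_mult_distrib flip: power_add)
  ultimately have "real S ^ 8 \<le> F * real (card (f ` T)) * (32 * (20 * real k * real Q) ^ 4 * real U ^ 4)"
    using k_pos Q U by (simp add: pos_divide_le_eq mult_ac)
  also have "\<dots> = 32 * (20 * real k * real Q) ^ 4 * (11 * real k)\<^sup>2 * (41 * (real k)\<^sup>2)\<^sup>2 * (real U ^ 4 * (real U)\<^sup>2) * real (card (f ` T))"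
    by (simp add: F_def power_mult_distrib)
  also have "real U ^ 4 * (real U)\<^sup>2 = real U ^ 6" by (simp flip: power_add)
  finally have "real S ^ 8 \<le> 32 * (20 * real k * real Q) ^ 4 * (11 * real k)\<^sup>2 * (41 * (real k)\<^sup>2)\<^sup>2 * real U ^ 6 * real (card (f ` T))" .
  moreover have "\<forall>L\<in>f ` T. rich_line (P_set k N) r L"
    using rich_line_of[OF S _ U(1) Q h(2)] hD(2) by (auto simp: T_def f_def D_def)
  ultimately show thesis using fin by (intro that[of "f ` T"]) auto
qed

text \<open>
  These lines take over when \<open>N / r\<close> is bounded: then \<open>N\<^sup>4 / r\<^sup>3\<close> is of order \<open>N\<close>, and the
  grid has at least \<open>N\<close> rows with at least \<open>N\<close> points each.
\<close>

lemma many_rich_lines_horizontal: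
  assumes "r \<le> card (A_set k N)"
  obtains \<L> where "finite \<L>" "\<forall>L\<in>\<L>. rich_line (P_set k N) r L" "card \<L> = card (A_set k N)"
proof -
  define H where "H = (\<lambda>c::real. line (0, c) (1, 0))"
  have H: "H c = UNIV \<times> {c}" for c
    by (auto simp: H_def line_def image_iff)
  have "rich_line (P_set k N) r (H c)" if "c \<in> A_set k N" for c
  proof -
    have "P_set k N \<inter> H c = A_set k N \<times> {c}" using that by (auto simp: H P_set_def)
    then show ?thesis
      using assms is_line_line[of "(1, 0)" "(0, c)"]
      by (simp add: rich_line_def card_cartesian_product H_def[symmetric]) (simp add: H_def zero_prod_def)
  qed
  moreover have "inj_on H (A_set k N)" by (rule inj_onI) (auto simp: H)
  ultimately show thesis
    using that[of "H ` A_set k N"] by (auto simp: finite_A_set card_image)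
qed

lemma many_rich_lines:
  obtains c :: real where "c > 0"
    "\<And>N r. r \<ge> 1 \<Longrightarrow> r \<le> N \<Longrightarrow> \<exists>\<L>. finite \<L> \<and> (\<forall>L\<in>\<L>. rich_line (P_set k N) r L) \<and>
       c * (real N ^ 4 / real r ^ 3) \<le> real (card \<L>)"
proof -
  obtain Q h0 where Q: "Q > 0" "h0 > 0"
    and dirs: "\<And>h. h \<ge> h0 \<Longrightarrow> real h ^ 4 / 2 \<le> real (card (directions Q h))"
    by (rule many_directions) blast
  define K where "K = 32 * (20 * real k * real Q) ^ 4 * (11 * real k)\<^sup>2 * (41 * (real k)\<^sup>2)\<^sup>2"
  define E where "E = real h0 * (10 * real k * real Q)"
  have K: "K > 0" and E: "E > 0" using Q k_pos by (auto simp: K_def E_def)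
  define c where "c = min (1 / (16384 * K)) (1 / (16 * E\<^sup>2) ^ 3)"
  have "c > 0" using K E by (simp add: c_def)
  have scale: "1 / t * x \<le> y" if "x \<le> t * y" "t > 0" for t x y :: real
    using that by (simp add: field_simps)
  have "\<exists>\<L>. finite \<L> \<and> (\<forall>L\<in>\<L>. rich_line (P_set k N) r L) \<and>
       c * (real N ^ 4 / real r ^ 3) \<le> real (card \<L>)" if r: "r \<ge> 1" "r \<le> N" for N r
  proof -
    define S where "S = nat \<lfloor>sqrt (real N)\<rfloor>"
    define U where "U = nat \<lceil>sqrt (real r)\<rceil>"
    have N1: "sqrt (real N) \<ge> 1" and r1: "sqrt (real r) \<ge> 1" using r by auto
    have S: "sqrt (real N) / 2 \<le> real S" "sqrt (real N) < real S + 1"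
    proof -
      have "\<lfloor>sqrt (real N)\<rfloor> \<ge> 1" using N1 by simp
      then show "sqrt (real N) / 2 \<le> real S" "sqrt (real N) < real S + 1"
        unfolding S_def by linarith+
    qed
    have U: "sqrt (real r) \<le> real U" "real U \<le> 2 * sqrt (real r)"
      unfolding U_def using r1 by linarith+
    have rU: "r \<le> U\<^sup>2"
    proof -
      have "(sqrt (real r))\<^sup>2 \<le> (real U)\<^sup>2" using U r1 by (intro power_mono) auto
      then have "real r \<le> real (U\<^sup>2)" by simp
      then show ?thesis by (simp only: of_nat_le_iff)
    qed
    have U0: "U > 0" using U r1 by (intro Nat.gr0I) auto
    have U2: "(real U)\<^sup>2 \<le> 4 * real r"
      using power_mono[OF U(2), of 2] by (simp add: power_mult_distrib)
    have S2: "real N \<le> 4 * (real S)\<^sup>2"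
      using power_mono[OF S(1), of 2] by (simp add: power_divide)
    define h where "h = S div (10 * k * Q * U)"
    \<comment> \<open>If \<open>h < h0\<close>, then \<open>S \<le> E * U\<close>, and hence \<open>N \<le> 16 * E\<^sup>2 * r\<close>.\<close>
    show ?thesis
    proof (cases "h \<ge> h0")
      case True
      then have "h > 0" using Q by simp
      obtain \<L> where L: "finite \<L>" "\<forall>L\<in>\<L>. rich_line (P_set k N) r L"
        "real S ^ 8 \<le> K * real U ^ 6 * real (card \<L>)"
        by (rule many_rich_lines_wide[OF S_def rU U0 Q(1) h_def \<open>h > 0\<close> dirs[OF True]])
           (simp add: K_def)
      have "real N ^ 4 \<le> (4 * (real S)\<^sup>2) ^ 4" using S2 by (intro power_mono) auto
      also have "\<dots> = 256 * real S ^ 8" by (simp add: power_mult_distrib flip: power_mult)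
      also have "\<dots> \<le> 256 * (K * real U ^ 6 * real (card \<L>))" using L(3) by simp
      also have "real U ^ 6 = ((real U)\<^sup>2) ^ 3" by (simp flip: power_mult)
      also have "256 * (K * ((real U)\<^sup>2) ^ 3 * real (card \<L>)) \<le> 256 * (K * (4 * real r) ^ 3 * real (card \<L>))"
        using U2 K by (intro mult_left_mono mult_right_mono power_mono) auto
      finally have "real N ^ 4 \<le> 16384 * K * real (card \<L>) * real r ^ 3" by (simp add: power_mult_distrib mult_ac)
      then have "real N ^ 4 / real r ^ 3 \<le> 16384 * K * real (card \<L>)" using r by (simp add: pos_divide_le_eq)
      then have "1 / (16384 * K) * (real N ^ 4 / real r ^ 3) \<le> real (card \<L>)" using K by (intro scale) auto
      moreover have "c * (real N ^ 4 / real r ^ 3) \<le> 1 / (16384 * K) * (real N ^ 4 / real r ^ 3)"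
        by (intro mult_right_mono) (auto simp: c_def)
      ultimately show ?thesis using L by fastforce
    next
      case False
      have NA: "real N \<le> real (card (A_set k N))"
      proof -
        have "(sqrt (real N))\<^sup>2 \<le> (2 * real S + 1)\<^sup>2" using S N1 by (intro power_mono) auto
        then show ?thesis by (simp add: add.commute card_A_set[OF S_def])
      qed
      then have "r \<le> card (A_set k N)" using r by linarith
      then obtain \<L> where L: "finite \<L>" "\<forall>L\<in>\<L>. rich_line (P_set k N) r L" "card \<L> = card (A_set k N)"
        by (rule many_rich_lines_horizontal)
      have "S < h0 * (10 * k * Q * U)"
        using False k_pos Q U0 by (simp add: h_def div_less_iff_less_mult not_le)
      then have "real S < real (h0 * (10 * k * Q * U))" by (simp only: of_nat_less_iff)
      then have "real S \<le> E * real U" by (simp add: E_def mult_ac)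
      then have "(real S)\<^sup>2 \<le> (E * real U)\<^sup>2" by (intro power_mono) auto
      also have "\<dots> \<le> E\<^sup>2 * (4 * real r)" using U2 by (simp add: power_mult_distrib mult_left_mono)
      finally have "real N \<le> 16 * E\<^sup>2 * real r" using S2 by linarith
      then have "real N ^ 3 \<le> (16 * E\<^sup>2 * real r) ^ 3" by (intro power_mono) auto
      also have "\<dots> = (16 * E\<^sup>2) ^ 3 * real r ^ 3" by (rule power_mult_distrib)
      finally have "real N * real N ^ 3 \<le> real N * ((16 * E\<^sup>2) ^ 3 * real r ^ 3)" by (intro mult_left_mono) auto
      then have "real N ^ 4 / real r ^ 3 \<le> (16 * E\<^sup>2) ^ 3 * real N"
        using r by (simp add: pos_divide_le_eq mult_ac power4_eq_xxxx power3_eq_cube)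
      then have "1 / (16 * E\<^sup>2) ^ 3 * (real N ^ 4 / real r ^ 3) \<le> real N"
        using E by (intro scale) auto
      moreover have "c * (real N ^ 4 / real r ^ 3) \<le> 1 / (16 * E\<^sup>2) ^ 3 * (real N ^ 4 / real r ^ 3)"
        by (intro mult_right_mono) (auto simp: c_def)
      ultimately show ?thesis using L NA by fastforce
    qed
  qed
  with \<open>c > 0\<close> show thesis by (rule that)
qed

lemma card_P_set_bounds:
  assumes "N \<ge> 1"
  shows "N \<le> card (P_set k N)" "card (P_set k N) \<le> 81 * N\<^sup>2"
proof -
  define S where "S = nat \<lfloor>sqrt (real N)\<rfloor>"
  have N1: "sqrt (real N) \<ge> 1" using assms by simp
  have S: "real S \<le> sqrt (real N)" "sqrt (real N) < real S + 1" unfolding S_def using N1 by linarith+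
  have P: "card (P_set k N) = ((2 * S + 1)\<^sup>2)\<^sup>2"
    using card_A_set[OF S_def] by (simp add: P_set_def card_cartesian_product power2_eq_square)
  have "(2 * real S + 1)\<^sup>2 \<le> (3 * sqrt (real N))\<^sup>2" using S N1 by (intro power_mono) linarith+
  then have "real ((2 * S + 1)\<^sup>2) \<le> real (9 * N)" by (simp add: power_mult_distrib add.commute)
  then have "(2 * S + 1)\<^sup>2 \<le> 9 * N" by (simp only: of_nat_le_iff)
  then have "((2 * S + 1)\<^sup>2)\<^sup>2 \<le> (9 * N)\<^sup>2" by (intro power_mono) auto
  then show "card (P_set k N) \<le> 81 * N\<^sup>2" by (simp add: P power_mult_distrib)
  have "(sqrt (real N))\<^sup>2 \<le> (2 * real S + 1)\<^sup>2" using S N1 by (intro power_mono) auto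
  then have "real N \<le> real ((2 * S + 1)\<^sup>2)" by (simp add: add.commute)
  then have "N \<le> (2 * S + 1)\<^sup>2" by (simp only: of_nat_le_iff)
  also have "\<dots> \<le> ((2 * S + 1)\<^sup>2)\<^sup>2" by (rule self_le_power) auto
  finally show "N \<le> card (P_set k N)" by (simp add: P)
qed

end

theorem theorem1p3:
  fixes k :: nat
  assumes "k > 0" and "\<not> (\<exists>m::nat. k = m ^ 2)"
  shows "\<exists>(C1::real) (C2::real) (N0::nat). C1 > 0 \<and> C2 > 0 \<and>
    (\<forall>(N::nat) (r::nat). N \<ge> N0 \<longrightarrow> r \<ge> 1 \<longrightarrow> r \<le> N \<longrightarrow>
      (\<exists>\<L> :: (real \<times> real) set set.
        finite \<L> \<and>
        (\<forall>L\<in>\<L>. rich_line (P_set k N) r L) \<and>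
        C1 * (real (card (P_set k N)) ^ 2 / real r ^ 3 + real (card (P_set k N)) / real r)
          \<le> real (card \<L>) \<and>
        real (card \<L>)
          \<le> C2 * (real (card (P_set k N)) ^ 2 / real r ^ 3 + real (card (P_set k N)) / real r)))"
proof -
  interpret nonsquare k by unfold_locales (use assms in auto)
  obtain c :: real where c: "c > 0"
    and rich: "\<And>N r. r \<ge> 1 \<Longrightarrow> r \<le> N \<Longrightarrow> \<exists>\<L>. finite \<L> \<and> (\<forall>L\<in>\<L>. rich_line (P_set k N) r L) \<and>
       c * (real N ^ 4 / real r ^ 3) \<le> real (card \<L>)"
    by (rule many_rich_lines) blast
  define C1 where "C1 = c / 6642"
  show ?thesis
  proof (rule exI[of _ C1], rule exI[of _ "C1 + 1"], rule exI[of _ 0], intro conjI allI impI)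
    show "C1 > 0" "C1 + 1 > 0" using c by (auto simp: C1_def)
    fix N r :: nat assume r: "1 \<le> r" "r \<le> N"
    define X where "X = real (card (P_set k N)) ^ 2 / real r ^ 3 + real (card (P_set k N)) / real r"
    have NP: "real N \<le> real (card (P_set k N))" "real (card (P_set k N)) \<le> 81 * (real N)\<^sup>2"
      using of_nat_mono[OF card_P_set_bounds(1), where 'a = real, of N]
        of_nat_mono[OF card_P_set_bounds(2), where 'a = real, of N] r by auto
    have "1 \<le> real (card (P_set k N)) / real r" using NP r by (simp add: pos_le_divide_eq)
    then have X1: "X \<ge> 1" by (simp add: X_def add_increasing)
    \<comment> \<open>The constant is \<open>81\<^sup>2 + 81\<close>; the second term of \<open>X\<close> is compared with the first by \<open>r \<le> N\<close>.\<close>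
    have X: "X \<le> 6642 * (real N ^ 4 / real r ^ 3)"
    proof -
      have "real (card (P_set k N)) ^ 2 \<le> (81 * (real N)\<^sup>2)\<^sup>2" using NP by (intro power_mono) auto
      also have "\<dots> = 6561 * real N ^ 4" by (simp add: power_mult_distrib flip: power_mult)
      finally have 1: "real (card (P_set k N)) ^ 2 / real r ^ 3 \<le> 6561 * real N ^ 4 / real r ^ 3"
        by (rule divide_right_mono) simp
      have "real (card (P_set k N)) / real r = real (card (P_set k N)) * (real r)\<^sup>2 / real r ^ 3"
        using r by (simp add: power2_eq_square power3_eq_cube)
      also have "\<dots> \<le> 81 * (real N)\<^sup>2 * (real N)\<^sup>2 / real r ^ 3"
        using NP r by (intro divide_right_mono mult_mono power_mono) auto
      finally have "real (card (P_set k N)) / real r \<le> 81 * real N ^ 4 / real r ^ 3"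
        by (simp add: power2_eq_square power4_eq_xxxx mult_ac)
      with 1 show ?thesis by (simp add: X_def)
    qed
    obtain \<L> where L: "finite \<L>" "\<forall>L\<in>\<L>. rich_line (P_set k N) r L"
      "c * (real N ^ 4 / real r ^ 3) \<le> real (card \<L>)"
      using rich[OF r] by blast
    have "C1 * X \<le> C1 * (6642 * (real N ^ 4 / real r ^ 3))"
      using X c by (intro mult_left_mono) (auto simp: C1_def)
    also have "\<dots> \<le> real (card \<L>)" using L(3) by (simp add: C1_def)
    finally have XL: "C1 * X \<le> real (card \<L>)" .
    \<comment> \<open>Keep just enough lines for the lower bound; as \<open>X \<ge> 1\<close>, rounding up costs at most \<open>X\<close>.\<close>
    define n where "n = nat \<lceil>C1 * X\<rceil>"
    have CX: "C1 * X \<ge> 0" using c X1 by (simp add: C1_def)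
    have "n \<le> card \<L>" unfolding n_def using XL by linarith
    then obtain \<M> where M: "\<M> \<subseteq> \<L>" "card \<M> = n" "finite \<M>" by (rule obtain_subset_with_card_n)
    have "C1 * X \<le> real n" "real n \<le> C1 * X + 1" unfolding n_def using CX by linarith+
    moreover have "C1 * X + 1 \<le> (C1 + 1) * X" using X1 by (simp add: distrib_right)
    ultimately show "\<exists>\<L>. finite \<L> \<and> (\<forall>L\<in>\<L>. rich_line (P_set k N) r L) \<and>
        C1 * (real (card (P_set k N)) ^ 2 / real r ^ 3 + real (card (P_set k N)) / real r) \<le> real (card \<L>) \<and>
        real (card \<L>) \<le> (C1 + 1) * (real (card (P_set k N)) ^ 2 / real r ^ 3 + real (card (P_set k N)) / real r)"
      using M L(2) unfolding X_def[symmetric] by (intro exI[of _ \<M>]) auto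
  qed
qed

end
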